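(* Let $E$ be a real linear space, let $h\in C(E)$ satisfy $h(t)>0$ for all $t\in E$, and let $d\in\mathbb{N}$ (so $d\ge 1$). The following statements are equivalent: (1) For every function $\varphi$ that is continuous on $[0,+\infty)$ and completely monotone on $(0,+\infty)$, the function $$K(x,t):=(h(t))^{-\frac d2}\,\varphi\left(\frac{\|x\|_2^2}{h(t)}\right),\qquad (x,t)\in\mathbb{R}^d\times E,$$ belongs to $\Phi(\mathbb{R}^d\times E)$. (2) For every $\lambda>0$, the function $t\mapsto e^{-\lambda h(t)}$ belongs to $\Phi(E)$.
   Context: For a real linear space $E$, $\Phi(E)$ denotes the set of positive definite functions on $E$: functions $f:E\to\mathbb{C}$ such that for every finite collection $\xi_1,\dots,\xi_n\in E$ and all $a_1,\dots,a_n\in\mathbb{C}$, $\sum_{i,j=1}^n a_i f(\xi_i-\xi_j)\overline{a_j}\ge 0$ (real and nonnegative). No continuity is part of this definition. $C(E)$: if $\dim E=n<\infty$ with basis $e_1,\dots,e_n$, then $f\in C(E)$ means that $(x_1,\dots,x_n)\mapsto f(x_1e_1+\dots+x_ne_n)$ is continuous on $\mathbb{R}^n$; if $\dim E=\infty$, then $f\in C(E)$ means that the restriction of $f$ to every finite-dimensional linear subspace $E_0$ of $E$ belongs to $C(E_0)$. A function $f:(0,\infty)\to\mathbb{R}$ is completely monotone if it is infinitely differentiable and $(-1)^n f^{(n)}(x)\ge 0$ for all $x>0$ and $n=0,1,2,\dots$. $\|\cdot\|_2$ is the Euclidean norm on $\mathbb{R}^d$. *)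

theory Defs
  imports "HOL-Analysis.Analysis"
begin

definition Phi :: "('e::real_vector \<Rightarrow> complex) set" where
  "Phi = {f. \<forall>n (\<xi> :: nat \<Rightarrow> 'e) (a :: nat \<Rightarrow> complex).
     (\<Sum>i<n. \<Sum>j<n. a i * f (\<xi> i - \<xi> j) * cnj (a j)) \<in> \<real>\<^sub>\<ge>\<^sub>0}"

definition is_basis :: "'e::real_vector set \<Rightarrow> nat \<Rightarrow> (nat \<Rightarrow> 'e) \<Rightarrow> bool" where
  "is_basis V n e \<longleftrightarrow> inj_on e {..<n} \<and> independent (e ` {..<n}) \<and> span (e ` {..<n}) = V"

text \<open>
  Linear subspaces are handled as sets \<open>V\<close>, and functions on them as restrictions of total
  functions: in the following definition only the values of \<open>f\<close> on \<open>V\<close> matter.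
  \<open>Euclidean_space n\<close> is the library's topological space of real \<open>n\<close>-tuples
  (sequences vanishing from index \<open>n\<close> on). The choice of the basis is immaterial,
  see \<open>coord_continuous_basis_iff\<close> below.
\<close>

definition coord_continuous :: "'e::real_vector set \<Rightarrow> ('e \<Rightarrow> 'b::topological_space) \<Rightarrow> bool" where
  "coord_continuous V f \<longleftrightarrow> (\<exists>n e. is_basis V n e \<and>
     continuous_map (Euclidean_space n) euclidean (\<lambda>x. f (\<Sum>i<n. x i *\<^sub>R e i)))"

definition fin_dim :: "'e::real_vector set \<Rightarrow> bool" where
  "fin_dim V \<longleftrightarrow> (\<exists>n e. is_basis V n e)"

definition C_space :: "('e::real_vector \<Rightarrow> 'b::topological_space) set" where
  "C_space = {f. if fin_dim (UNIV :: 'e set) then coord_continuous UNIV f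
                 else (\<forall>V. subspace V \<and> fin_dim V \<longrightarrow> coord_continuous V f)}"

text \<open>
  The values of \<open>f\<close> outside of \<open>{0<..}\<close> are irrelevant here: \<open>{0<..}\<close> is open, so the iterated
  derivatives at \<open>x > 0\<close> only depend on \<open>f\<close> near \<open>x\<close>.
\<close>

definition completely_monotone :: "(real \<Rightarrow> real) \<Rightarrow> bool" where
  "completely_monotone f \<longleftrightarrow> (\<forall>n. \<forall>x>0.
     (deriv ^^ n) f differentiable (at x) \<and> (-1) ^ n * (deriv ^^ n) f x \<ge> 0)"

lemma coord_continuous_change_basis:
  fixes f :: "'e::real_vector \<Rightarrow> 'b::topological_space"
  assumes e: "is_basis V n e" and e': "is_basis V m e'"
    and cont: "continuous_map (Euclidean_space n) euclidean (\<lambda>x. f (\<Sum>i<n. x i *\<^sub>R e i))"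
  shows "continuous_map (Euclidean_space m) euclidean (\<lambda>x. f (\<Sum>j<m. x j *\<^sub>R e' j))"
proof -
  have "\<exists>u. e' j = (\<Sum>i<n. u i *\<^sub>R e i)" if "j < m" for j
  proof -
    have "e' j \<in> span (e ` {..<n})"
      using e e' that span_base[of "e' j" "e' ` {..<m}"] by (auto simp: is_basis_def)
    then obtain u where "e' j = (\<Sum>v\<in>e ` {..<n}. u v *\<^sub>R v)"
      by (auto simp: span_finite)
    also have "\<dots> = (\<Sum>i<n. u (e i) *\<^sub>R e i)"
      using e by (subst sum.reindex) (auto simp: is_basis_def)
    finally show ?thesis by (intro exI[of _ "\<lambda>i. u (e i)"])
  qed
  then obtain c where c: "\<And>j. j < m \<Longrightarrow> e' j = (\<Sum>i<n. c j i *\<^sub>R e i)" by metis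
  define L where "L = (\<lambda>(x :: nat \<Rightarrow> real) i. if i < n then \<Sum>j<m. x j * c j i else 0)"
  have "continuous_map (Euclidean_space m) (Euclidean_space n) L"
    unfolding L_def continuous_map_componentwise_Euclidean_space
    by (auto intro!: continuous_intros simp: continuous_map_Euclidean_space_iff
        intro: continuous_on_subset[OF continuous_on_product_coordinates])
  then have "continuous_map (Euclidean_space m) euclidean
      ((\<lambda>x. f (\<Sum>i<n. x i *\<^sub>R e i)) \<circ> L)"
    using cont by (rule continuous_map_compose)
  moreover have "(\<Sum>i<n. L x i *\<^sub>R e i) = (\<Sum>j<m. x j *\<^sub>R e' j)" for x
  proof -
    have "(\<Sum>i<n. L x i *\<^sub>R e i) = (\<Sum>i<n. \<Sum>j<m. (x j * c j i) *\<^sub>R e i)"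
      by (simp add: L_def scaleR_sum_left)
    also have "\<dots> = (\<Sum>j<m. \<Sum>i<n. (x j * c j i) *\<^sub>R e i)"
      by (rule sum.swap)
    also have "\<dots> = (\<Sum>j<m. x j *\<^sub>R e' j)"
      by (simp add: c scaleR_sum_right)
    finally show ?thesis .
  qed
  ultimately show ?thesis by (simp add: o_def)
qed

lemma coord_continuous_basis_iff:
  assumes "is_basis V n e"
  shows "coord_continuous V f \<longleftrightarrow>
    continuous_map (Euclidean_space n) euclidean (\<lambda>x. f (\<Sum>i<n. x i *\<^sub>R e i))"
  using assms coord_continuous_change_basis unfolding coord_continuous_def by blast

end

(* A Gaussian is the Fourier transform of a Gaussian: up to a constant, h^(-1/2) exp(-x^2 / (4 h))
   is the integral of exp(i x y) exp(-y^2 h) over y. So if exp(-l h) is positive definite in t for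
   every l > 0, integrating characters in x against exp(-(l + y^2) h) shows, one coordinate at a
   time, that h^(-d/2) exp(-u |x|^2 / h) is positive definite for every u >= 0. A completely monotone
   function that is continuous at 0 is a pointwise limit of positive combinations of functions
   exp(-u s), because its values on a lattice are approximated by the discrete measures of
   Hausdorff's moment theorem; full strength of Bernstein's theorem is not required. This gives (1).
   Conversely, (1) for phi(s) = exp(-s / 4) yields exp(-l h) by integrating out the coordinates of x
   one after another; such a partial Fourier transform preserves positive definiteness because it
   is a limit of Fejer-type double sums. *)
theory Submission
  imports Defs "HOL-Probability.Characteristic_Functions"
begin

subsection \<open>Closure properties of positive definite functions\<close>

text \<open>Frees the quadratic form from the index set \<open>{..<n}\<close>, so that it can run
  over products of index sets as in \<open>Phi_double_sum\<close>.\<close>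

lemma Phi_finite_sum:
  fixes f :: "'e::real_vector \<Rightarrow> complex" and \<xi> :: "'i \<Rightarrow> 'e"
  assumes f: "f \<in> Phi" and A: "finite A"
  shows "(\<Sum>i\<in>A. \<Sum>j\<in>A. a i * f (\<xi> i - \<xi> j) * cnj (a j)) \<in> \<real>\<^sub>\<ge>\<^sub>0"
proof -
  obtain b where b: "bij_betw b {..<card A} A"
    using A ex_bij_betw_nat_finite lessThan_atLeast0 by metis
  have "(\<Sum>i\<in>A. \<Sum>j\<in>A. a i * f (\<xi> i - \<xi> j) * cnj (a j)) =
    (\<Sum>i<card A. \<Sum>j<card A. a (b i) * f (\<xi> (b i) - \<xi> (b j)) * cnj (a (b j)))"
    by (simp add: sum.reindex_bij_betw[OF b, symmetric])
  also have "\<dots> \<in> \<real>\<^sub>\<ge>\<^sub>0"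
    using f unfolding Phi_def by (auto dest!: spec[of _ "\<xi> \<circ> b"] spec[of _ "a \<circ> b"] spec[of _ "card A"])
  finally show ?thesis .
qed

lemma Phi_zero: "(\<lambda>_. 0) \<in> Phi"
  by (simp add: Phi_def)

lemma Phi_scale:
  assumes "f \<in> Phi" and "c \<ge> 0"
  shows "(\<lambda>s. complex_of_real c * f s) \<in> Phi"
proof -
  have "(\<Sum>i<n. \<Sum>j<n. a i * (complex_of_real c * f (\<xi> i - \<xi> j)) * cnj (a j)) =
    complex_of_real c * (\<Sum>i<n. \<Sum>j<n. a i * f (\<xi> i - \<xi> j) * cnj (a j))" for n :: nat and a \<xi>
    by (simp add: sum_distrib_left mult_ac)
  with assms show ?thesis
    by (auto simp: Phi_def)
qed

lemma Phi_add:
  assumes "f \<in> Phi" and "g \<in> Phi"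
  shows "(\<lambda>s. f s + g s) \<in> Phi"
  using assms by (auto simp: Phi_def algebra_simps sum.distrib)

lemma Phi_sum:
  assumes "\<And>j. j \<in> J \<Longrightarrow> f j \<in> Phi"
  shows "(\<lambda>s. \<Sum>j\<in>J. f j s) \<in> Phi"
  using assms by (induction J rule: infinite_finite_induct) (auto intro: Phi_zero Phi_add)

lemma Phi_compose:
  assumes "f \<in> Phi" and "\<And>x y. g (x - y) = g x - g y"
  shows "(\<lambda>s. f (g s)) \<in> Phi"
  using assms(1) unfolding Phi_def by (auto simp: assms(2) dest: spec[of _ "\<lambda>i. g (_ i)"])

lemma Phi_tendsto:
  assumes "\<And>m. f m \<in> Phi" and "\<And>s. (\<lambda>m. f m s) \<longlonglongrightarrow> g s"
  shows "g \<in> Phi"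
  unfolding Phi_def
proof (safe)
  fix n :: nat and \<xi> :: "nat \<Rightarrow> 'a" and a :: "nat \<Rightarrow> complex"
  have "(\<lambda>m. \<Sum>i<n. \<Sum>j<n. a i * f m (\<xi> i - \<xi> j) * cnj (a j)) \<longlonglongrightarrow>
      (\<Sum>i<n. \<Sum>j<n. a i * g (\<xi> i - \<xi> j) * cnj (a j))"
    by (intro tendsto_intros assms(2))
  moreover have "(\<Sum>i<n. \<Sum>j<n. a i * f m (\<xi> i - \<xi> j) * cnj (a j)) \<in> \<real>\<^sub>\<ge>\<^sub>0" for m
    using assms(1)[of m] by (simp add: Phi_def)
  ultimately show "(\<Sum>i<n. \<Sum>j<n. a i * g (\<xi> i - \<xi> j) * cnj (a j)) \<in> \<real>\<^sub>\<ge>\<^sub>0"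
    by (intro Lim_in_closed_set[OF closed_nonneg_Reals_complex]) auto
qed

text \<open>At \<open>x - y\<close> the character splits as
  \<open>cis (l x) * cnj (cis (l y))\<close>, so it is absorbed into the coefficients.\<close>

lemma Phi_mult_cis:
  assumes "f \<in> Phi" and l: "\<And>x y. l (x - y) = l x - l y"
  shows "(\<lambda>s. cis (l s) * f s) \<in> Phi"
  unfolding Phi_def
proof safe
  fix n :: nat and \<xi> :: "nat \<Rightarrow> 'a" and a :: "nat \<Rightarrow> complex"
  have "(\<Sum>i<n. \<Sum>j<n. a i * (cis (l (\<xi> i - \<xi> j)) * f (\<xi> i - \<xi> j)) * cnj (a j)) =
     (\<Sum>i<n. \<Sum>j<n. (a i * cis (l (\<xi> i))) * f (\<xi> i - \<xi> j) * cnj (a j * cis (l (\<xi> j))))"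
    by (intro sum.cong refl) (simp add: l cis_cnj flip: cis_mult, simp add: cis_mult mult_ac)
  also have "\<dots> \<in> \<real>\<^sub>\<ge>\<^sub>0"
    using Phi_finite_sum[OF assms(1), of "{..<n}" "\<lambda>i. a i * cis (l (\<xi> i))" \<xi>] by simp
  finally show "(\<Sum>i<n. \<Sum>j<n. a i * (cis (l (\<xi> i - \<xi> j)) * f (\<xi> i - \<xi> j)) * cnj (a j)) \<in> \<real>\<^sub>\<ge>\<^sub>0" .
qed

lemma integral_nonneg_Reals:
  fixes f :: "'a \<Rightarrow> complex"
  assumes "\<And>y. f y \<in> \<real>\<^sub>\<ge>\<^sub>0"
  shows "(\<integral>y. f y \<partial>M) \<in> \<real>\<^sub>\<ge>\<^sub>0"
proof -
  have "f y = complex_of_real (Re (f y))" for y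
    using assms[of y] by (auto simp: complex_nonneg_Reals_iff complex_eq_iff)
  then have "(\<integral>y. f y \<partial>M) = complex_of_real (\<integral>y. Re (f y) \<partial>M)"
    by (metis (no_types, lifting) Bochner_Integration.integral_cong integral_complex_of_real)
  moreover have "0 \<le> (\<integral>y. Re (f y) \<partial>M)"
    using assms by (intro integral_nonneg_AE) (auto simp: complex_nonneg_Reals_iff)
  ultimately show ?thesis by simp
qed

lemma Phi_integral:
  fixes f :: "'y \<Rightarrow> 'e::real_vector \<Rightarrow> complex"
  assumes "\<And>y. f y \<in> Phi" and int: "\<And>s. integrable M (\<lambda>y. f y s)"
  shows "(\<lambda>s. \<integral>y. f y s \<partial>M) \<in> Phi"
  unfolding Phi_def
proof safe
  fix n :: nat and \<xi> :: "nat \<Rightarrow> 'e" and a :: "nat \<Rightarrow> complex"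
  have "(\<Sum>i<n. \<Sum>j<n. a i * (\<integral>y. f y (\<xi> i - \<xi> j) \<partial>M) * cnj (a j)) =
     (\<integral>y. (\<Sum>i<n. \<Sum>j<n. a i * f y (\<xi> i - \<xi> j) * cnj (a j)) \<partial>M)"
    using int by simp
  also have "\<dots> \<in> \<real>\<^sub>\<ge>\<^sub>0"
    using assms(1) by (intro integral_nonneg_Reals) (auto simp: Phi_def)
  finally show "(\<Sum>i<n. \<Sum>j<n. a i * (\<integral>y. f y (\<xi> i - \<xi> j) \<partial>M) * cnj (a j)) \<in> \<real>\<^sub>\<ge>\<^sub>0" .
qed

subsection \<open>Fourier transforms of Gaussians\<close>

lemma gaussian_fourier_std:
  "integrable lborel (\<lambda>x. cis (t * x) * complex_of_real (exp (- x\<^sup>2 / 2)))"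
  "(\<integral>x. cis (t * x) * complex_of_real (exp (- x\<^sup>2 / 2)) \<partial>lborel) =
     complex_of_real (sqrt (2 * pi) * exp (- t\<^sup>2 / 2))"
proof -
  have eq: "cis (t * x) * complex_of_real (exp (- x\<^sup>2 / 2)) =
     complex_of_real (sqrt (2 * pi)) * (std_normal_density x *\<^sub>R cis (t * x))" for x
    by (simp add: std_normal_density_def scaleR_conv_of_real field_simps flip: of_real_mult)
  have int: "integrable lborel (\<lambda>x. std_normal_density x *\<^sub>R cis (t * x))"
  proof (rule Bochner_Integration.integrable_bound[of _ std_normal_density])
    show "integrable lborel std_normal_density" by (rule integrable_normal_density) simp
    show "(\<lambda>x. std_normal_density x *\<^sub>R cis (t * x)) \<in> borel_measurable lborel"
      by (simp, intro borel_measurable_continuous_onI continuous_intros)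
         (auto simp: normal_density_def intro!: continuous_intros)
  qed (simp add: normal_density_nonneg)
  then show "integrable lborel (\<lambda>x. cis (t * x) * complex_of_real (exp (- x\<^sup>2 / 2)))"
    unfolding eq by (rule integrable_mult_right)
  have "(\<integral>x. std_normal_density x *\<^sub>R cis (t * x) \<partial>lborel) = char std_normal_distribution t"
    unfolding char_def cis_conv_exp
    by (subst integral_density) (auto simp: normal_density_nonneg mult_ac)
  also have "\<dots> = complex_of_real (exp (- t\<^sup>2 / 2))"
    by (simp add: char_std_normal_distribution)
  finally have *: "(\<integral>x. std_normal_density x *\<^sub>R cis (t * x) \<partial>lborel) = complex_of_real (exp (- t\<^sup>2 / 2))" .
  show "(\<integral>x. cis (t * x) * complex_of_real (exp (- x\<^sup>2 / 2)) \<partial>lborel) =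
     complex_of_real (sqrt (2 * pi) * exp (- t\<^sup>2 / 2))"
    unfolding eq integral_mult_right_zero * by simp
qed

lemma gaussian_fourier:
  fixes c :: real
  assumes c: "c > 0"
  shows "integrable lborel (\<lambda>x. cis (t * x) * complex_of_real (exp (- c * (x + b)\<^sup>2)))"
    and "(\<integral>x. cis (t * x) * complex_of_real (exp (- c * (x + b)\<^sup>2)) \<partial>lborel) =
      cis (- t * b) * complex_of_real (sqrt (pi / c) * exp (- t\<^sup>2 / (4 * c)))"
proof -
  \<comment> \<open>With \<open>r\<^sup>2 = 2 * c\<close>, replacing \<open>x\<close> by
    \<open>r * (x + b)\<close> turns the standard exponent into the required one; the shift by
    \<open>b\<close> costs only a phase.\<close>
  define r where "r = sqrt (2 * c)"
  have r: "r > 0" "r\<^sup>2 = 2 * c" using c by (auto simp: r_def)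
  define f where "f x = cis (t / r * x) * complex_of_real (exp (- x\<^sup>2 / 2))" for x :: real
  have f: "integrable lborel f" "integral\<^sup>L lborel f = complex_of_real (sqrt (2 * pi) * exp (- (t / r)\<^sup>2 / 2))"
    unfolding f_def using gaussian_fourier_std[of "t / r"] by auto
  have sq: "- c * (x + b)\<^sup>2 = - (r * b + r * x)\<^sup>2 / 2" for x
  proof -
    have "(r * b + r * x)\<^sup>2 = r\<^sup>2 * (x + b)\<^sup>2" by (simp add: power2_eq_square algebra_simps)
    with r show ?thesis by simp
  qed
  have eq: "cis (t * x) * complex_of_real (exp (- c * (x + b)\<^sup>2)) = cis (- t * b) * f (r * b + r * x)" for x
    unfolding f_def sq using r by (simp add: mult.assoc[symmetric] cis_mult add_divide_distrib distrib_left)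
  show "integrable lborel (\<lambda>x. cis (t * x) * complex_of_real (exp (- c * (x + b)\<^sup>2)))"
    unfolding eq using lborel_integrable_real_affine[OF f(1), of r "r * b"] r by simp
  have "(\<integral>x. f (r * b + r * x) \<partial>lborel) = complex_of_real (1 / r) * integral\<^sup>L lborel f"
    using lborel_integral_real_affine[of r f "r * b"] r by (simp add: scaleR_conv_of_real field_simps)
  also have "\<dots> = complex_of_real (1 / r * (sqrt (2 * pi) * exp (- (t / r)\<^sup>2 / 2)))"
    unfolding f by simp
  also have "1 / r * (sqrt (2 * pi) * exp (- (t / r)\<^sup>2 / 2)) = sqrt (pi / c) * exp (- t\<^sup>2 / (4 * c))"
    using c r by (simp add: power_divide) (simp add: r_def real_sqrt_mult real_sqrt_divide field_simps)
  finally show "(\<integral>x. cis (t * x) * complex_of_real (exp (- c * (x + b)\<^sup>2)) \<partial>lborel) =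
      cis (- t * b) * complex_of_real (sqrt (pi / c) * exp (- t\<^sup>2 / (4 * c)))"
    unfolding eq by simp
qed

lemma integrable_gaussian:
  fixes c b :: real
  assumes "c > 0"
  shows "integrable lborel (\<lambda>x. exp (- c * (x + b)\<^sup>2))"
  using integrable_norm[OF gaussian_fourier(1)[OF assms, of 0 b]] by (simp add: norm_mult)

subsection \<open>Partial Fourier transforms of positive definite functions\<close>

text \<open>The summands are the column, the row and the corner by which the square of index pairs
  grows in the induction for \<open>sum_differences\<close>.\<close>

lemma sum_symmetric_int_interval:
  fixes f :: "int \<Rightarrow> 'a::comm_monoid_add"
  shows "(\<Sum>m\<in>{- int N..int N}. f m) = (\<Sum>p<N. f (int p - int N)) + (\<Sum>q<N. f (int N - int q)) + f 0"
proof -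
  have U: "{- int N..int N} = {- int N..<0} \<union> ({0<..int N} \<union> {0})" by auto
  have "(\<Sum>m\<in>{- int N..<0}. f m) = (\<Sum>p<N. f (int p - int N))"
    by (rule sum.reindex_bij_witness[of _ "\<lambda>p. int p - int N" "\<lambda>m. nat (m + int N)"]) auto
  moreover have "(\<Sum>m\<in>{0<..int N}. f m) = (\<Sum>q<N. f (int N - int q))"
    by (rule sum.reindex_bij_witness[of _ "\<lambda>q. int N - int q" "\<lambda>m. nat (int N - m)"]) auto
  ultimately show ?thesis
    unfolding U by (subst sum.union_disjoint) (auto simp: sum.union_disjoint add_ac)
qed

text \<open>For \<bar>m\<bar> at most \<open>N\<close> there are \<open>N - \<bar>m\<bar>\<close>
  pairs with difference \<open>m\<close>. Enlarging the square adds every difference from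
  \<open>- N\<close> to \<open>N\<close> exactly once.\<close>

lemma sum_differences:
  fixes f :: "int \<Rightarrow> 'a::comm_ring_1"
  shows "(\<Sum>p<N. \<Sum>q<N. f (int p - int q)) = (\<Sum>m\<in>{- int N..int N}. of_int (int N - \<bar>m\<bar>) * f m)"
proof (induction N)
  case (Suc N)
  have "(\<Sum>p<Suc N. \<Sum>q<Suc N. f (int p - int q)) =
      (\<Sum>p<N. \<Sum>q<N. f (int p - int q)) +
      ((\<Sum>p<N. f (int p - int N)) + (\<Sum>q<N. f (int N - int q)) + f 0)"
    by (simp add: sum.distrib)
  also have "\<dots> = (\<Sum>m\<in>{- int N..int N}. of_int (int N - \<bar>m\<bar>) * f m) + (\<Sum>m\<in>{- int N..int N}. f m)"
    by (simp only: Suc sum_symmetric_int_interval)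
  also have "\<dots> = (\<Sum>m\<in>{- int N..int N}. of_int (int (Suc N) - \<bar>m\<bar>) * f m)"
    unfolding sum.distrib[symmetric] by (intro sum.cong refl) (simp add: algebra_simps)
  also have "\<dots> = (\<Sum>m\<in>{- int (Suc N)..int (Suc N)}. of_int (int (Suc N) - \<bar>m\<bar>) * f m)"
  proof (rule sum.mono_neutral_left)
    show "\<forall>m\<in>{- int (Suc N)..int (Suc N)} - {- int N..int N}. of_int (int (Suc N) - \<bar>m\<bar>) * f m = 0"
    proof
      fix m assume "m \<in> {- int (Suc N)..int (Suc N)} - {- int N..int N}"
      then have "int (Suc N) - \<bar>m\<bar> = 0" by auto
      then show "of_int (int (Suc N) - \<bar>m\<bar>) * f m = 0" by simp
    qed
  qed auto
  finally show ?case .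
qed simp

text \<open>
  The double sum equals the Fejer-weighted sum over all differences \<open>m / (M + 1)\<close>, which is a
  Riemann sum of mesh \<open>1 / (M + 1)\<close> whose weights tend to \<open>1\<close>.
\<close>

lemma fejer_riemann_sum_tendsto:
  fixes g :: "real \<Rightarrow> complex"
  assumes g: "continuous_on UNIV g"
    and W: "integrable lborel W" "\<And>x y. \<bar>y - x\<bar> \<le> 1 \<Longrightarrow> norm (g y) \<le> W x"
  shows "(\<lambda>M. (\<Sum>p<(Suc M)\<^sup>2. \<Sum>q<(Suc M)\<^sup>2. g (real p / Suc M - real q / Suc M)) / complex_of_real (real (Suc M) ^ 3))
     \<longlonglongrightarrow> (\<integral>x. g x \<partial>lborel)"
proof -
  \<comment> \<open>A step function whose integral is the given sum: the sample points have mesh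
    \<open>1 / (M + 1)\<close> and fill \<open>[- (M + 1), M + 1]\<close>. The cube is the Fejer
    denominator \<open>(M + 1)^2\<close> times the inverse mesh.\<close>
  define S where "S M x = (\<Sum>m\<in>{- int ((Suc M)\<^sup>2)..int ((Suc M)\<^sup>2)}.
      indicator {m / Suc M..<(m + 1) / Suc M} x *\<^sub>R (of_real (1 - \<bar>m\<bar> / (Suc M)\<^sup>2) * g (m / Suc M)))"
    for M and x :: real
  have indicator: "has_bochner_integral lborel (\<lambda>x. indicator {a..<b} x *\<^sub>R z) (measure lborel {a..<b} *\<^sub>R z)"
    for a b :: real and z :: complex
    by (intro has_bochner_integral_scaleR_left has_bochner_integral_real_indicator)
       (cases "a \<le> b"; simp)+
  have S_int: "(\<integral>x. S M x \<partial>lborel) =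
     (\<Sum>p<(Suc M)\<^sup>2. \<Sum>q<(Suc M)\<^sup>2. g (real p / Suc M - real q / Suc M)) / complex_of_real (real (Suc M) ^ 3)" for M
  proof -
    define N where "N = (Suc M)\<^sup>2"
    have N: "real N = (real (Suc M))\<^sup>2" "N > 0" by (simp_all add: N_def)
    have "(\<integral>x. S M x \<partial>lborel) = (\<Sum>m\<in>{- int N..int N}.
      (1 / Suc M) *\<^sub>R (of_real (1 - \<bar>m\<bar> / N) * g (m / Suc M)))"
    proof -
      have "(\<integral>x. S M x \<partial>lborel) = (\<Sum>m\<in>{- int N..int N}.
        measure lborel {m / Suc M..<(m + 1) / Suc M} *\<^sub>R (of_real (1 - \<bar>m\<bar> / N) * g (m / Suc M)))"
        unfolding S_def N_def
        by (intro has_bochner_integral_integral_eq has_bochner_integral_sum indicator)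
      then show ?thesis
        by (simp add: divide_right_mono diff_divide_distrib[symmetric] del: of_nat_Suc)
    qed
    also have "\<dots> = (\<Sum>m\<in>{- int N..int N}. of_int (int N - \<bar>m\<bar>) * g (m / Suc M)) / complex_of_real (real (Suc M) ^ 3)"
      unfolding sum_divide_distrib
    proof (intro sum.cong refl)
      fix m :: int
      have "1 / Suc M * (1 - \<bar>m\<bar> / N) = (real N - \<bar>m\<bar>) / real (Suc M) ^ 3"
      proof -
        have "1 / r * (1 - b / r\<^sup>2) = (r\<^sup>2 - b) / r ^ 3" if "r > 0" for r b :: real
          using that by (simp add: field_simps power2_eq_square power3_eq_cube)
        from this[of "real (Suc M)"] show ?thesis by (simp only: N)
      qed
      from arg_cong[OF this, of complex_of_real]
      show "(1 / Suc M) *\<^sub>R (of_real (1 - \<bar>m\<bar> / N) * g (m / Suc M)) =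
         of_int (int N - \<bar>m\<bar>) * g (m / Suc M) / complex_of_real (real (Suc M) ^ 3)"
        by (simp add: scaleR_conv_of_real mult.assoc[symmetric] del: of_nat_Suc of_int_abs)
    qed
    also have "(\<Sum>m\<in>{- int N..int N}. of_int (int N - \<bar>m\<bar>) * g (m / Suc M)) =
       (\<Sum>p<N. \<Sum>q<N. g (real p / Suc M - real q / Suc M))"
      using sum_differences[of "\<lambda>m. g (m / Suc M)" N] by (simp add: diff_divide_distrib)
    finally show ?thesis unfolding N_def .
  qed
  \<comment> \<open>Only the cell containing \<open>x\<close> contributes, and its index is the
    floor of \<open>Suc M * x\<close>.\<close>
  have S_eq: "S M x = (if \<bar>\<lfloor>Suc M * x\<rfloor>\<bar> \<le> int ((Suc M)\<^sup>2)
      then of_real (1 - \<bar>\<lfloor>Suc M * x\<rfloor>\<bar> / (Suc M)\<^sup>2) * g (\<lfloor>Suc M * x\<rfloor> / Suc M) else 0)" for M :: nat and x :: real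
  proof -
    have "indicator {m / Suc M..<(m + 1) / Suc M} x = (if m = \<lfloor>Suc M * x\<rfloor> then 1 else 0 :: real)" for m :: int
    proof -
      have "m = \<lfloor>Suc M * x\<rfloor> \<longleftrightarrow> real_of_int m \<le> Suc M * x \<and> Suc M * x < real_of_int m + 1"
        using floor_eq_iff[of "Suc M * x" m] by auto
      also have "\<dots> \<longleftrightarrow> x \<in> {m / Suc M..<(m + 1) / Suc M}"
        by (simp add: pos_divide_le_eq pos_less_divide_eq mult.commute del: of_nat_Suc)
      finally show ?thesis by (simp add: indicator_def)
    qed
    then have "S M x = (\<Sum>m\<in>{- int ((Suc M)\<^sup>2)..int ((Suc M)\<^sup>2)}. if m = \<lfloor>Suc M * x\<rfloor> then
       of_real (1 - \<bar>m\<bar> / (Suc M)\<^sup>2) * g (m / Suc M) else 0)"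
      unfolding S_def by (intro sum.cong refl) simp
    also have "\<dots> = (if \<bar>\<lfloor>Suc M * x\<rfloor>\<bar> \<le> int ((Suc M)\<^sup>2)
      then of_real (1 - \<bar>\<lfloor>Suc M * x\<rfloor>\<bar> / (Suc M)\<^sup>2) * g (\<lfloor>Suc M * x\<rfloor> / Suc M) else 0)"
      by (subst sum.delta) (auto simp del: of_nat_Suc)
    finally show ?thesis .
  qed
  have near: "\<bar>\<lfloor>Suc M * x\<rfloor> / Suc M - x\<bar> \<le> 1 / Suc M" for M :: nat and x :: real
  proof -
    have "\<bar>\<lfloor>Suc M * x\<rfloor> - Suc M * x\<bar> \<le> 1" by linarith
    then have "\<bar>\<lfloor>Suc M * x\<rfloor> - Suc M * x\<bar> / Suc M \<le> 1 / Suc M" by (intro divide_right_mono) auto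
    also have "\<bar>\<lfloor>Suc M * x\<rfloor> - Suc M * x\<bar> / Suc M = \<bar>\<lfloor>Suc M * x\<rfloor> / Suc M - x\<bar>"
      by (subst abs_divide[symmetric, of _ "real (Suc M)", simplified abs_of_nat]) (simp add: diff_divide_distrib del: of_nat_Suc)
    finally show ?thesis .
  qed
  have lim: "(\<lambda>M. S M x) \<longlonglongrightarrow> g x" for x
  proof -
    have inv: "(\<lambda>M. 1 / real (Suc M)) \<longlonglongrightarrow> 0" by real_asymp
    have "(\<lambda>M. \<lfloor>Suc M * x\<rfloor> / Suc M - x) \<longlonglongrightarrow> 0"
      by (rule tendsto_0_le[OF inv, of _ 1]) (use near in auto)
    from tendsto_add[OF this tendsto_const[of x]]
    have l1: "(\<lambda>M. \<lfloor>Suc M * x\<rfloor> / Suc M) \<longlonglongrightarrow> x" by simp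
    have "(\<lambda>M. \<bar>\<lfloor>Suc M * x\<rfloor> / Suc M\<bar> * (1 / Suc M)) \<longlonglongrightarrow> \<bar>x\<bar> * 0"
      by (intro tendsto_intros l1 inv)
    then have l2: "(\<lambda>M. \<bar>\<lfloor>Suc M * x\<rfloor>\<bar> / (Suc M)\<^sup>2) \<longlonglongrightarrow> 0"
      by (simp add: power2_eq_square del: of_nat_Suc mult_Suc mult_Suc_right)
    have "(\<lambda>M. of_real (1 - \<bar>\<lfloor>Suc M * x\<rfloor>\<bar> / (Suc M)\<^sup>2) * g (\<lfloor>Suc M * x\<rfloor> / Suc M)) \<longlonglongrightarrow> of_real (1 - 0) * g x"
      by (intro tendsto_mult tendsto_of_real tendsto_diff tendsto_const l2 continuous_on_tendsto_compose[OF g l1]) auto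
    \<comment> \<open>A ratio below 1 means that \<open>x\<close> has entered the window, so the
      first branch of \<open>S_eq\<close> applies.\<close>
    moreover have "\<forall>\<^sub>F M in sequentially. \<bar>\<lfloor>Suc M * x\<rfloor>\<bar> / (Suc M)\<^sup>2 < 1"
      using order_tendstoD(2)[OF l2, of 1] by simp
    then have "\<forall>\<^sub>F M in sequentially. of_real (1 - \<bar>\<lfloor>Suc M * x\<rfloor>\<bar> / (Suc M)\<^sup>2) * g (\<lfloor>Suc M * x\<rfloor> / Suc M) = S M x"
    proof eventually_elim
      case (elim M)
      then have "real_of_int \<bar>\<lfloor>Suc M * x\<rfloor>\<bar> < real_of_int (int ((Suc M)\<^sup>2))"
        by (simp add: divide_less_eq)
      then show ?case unfolding S_eq of_int_less_iff by auto
    qed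
    ultimately have "(\<lambda>M. S M x) \<longlonglongrightarrow> of_real (1 - 0) * g x"
      by (rule Lim_transform_eventually)
    then show ?thesis by simp
  qed
  \<comment> \<open>The weight lies in \<open>[0, 1]\<close> and the sample point within 1 of
    \<open>x\<close>; this is why \<open>W x\<close> dominates \<open>g\<close> on a unit
    neighbourhood of \<open>x\<close>.\<close>
  have bound: "norm (S M x) \<le> W x" for M x
  proof (cases "\<bar>\<lfloor>Suc M * x\<rfloor>\<bar> \<le> int ((Suc M)\<^sup>2)")
    case True
    define b where "b = \<bar>\<lfloor>Suc M * x\<rfloor>\<bar> / real ((Suc M)\<^sup>2)"
    have "real_of_int \<bar>\<lfloor>Suc M * x\<rfloor>\<bar> \<le> real_of_int (int ((Suc M)\<^sup>2))"
      using True unfolding of_int_le_iff .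
    then have "0 \<le> b" "b \<le> 1"
      unfolding b_def by (simp_all add: divide_le_eq_1 del: of_nat_Suc)
    then have "\<bar>1 - b\<bar> \<le> 1" by linarith
    moreover have "1 / real (Suc M) \<le> 1" by simp
    then have "norm (g (\<lfloor>Suc M * x\<rfloor> / Suc M)) \<le> W x"
      by (rule W(2)[OF order_trans[OF near]])
    ultimately have "\<bar>1 - b\<bar> * norm (g (\<lfloor>Suc M * x\<rfloor> / Suc M)) \<le> 1 * W x"
      by (rule mult_mono) auto
    then show ?thesis
      unfolding S_eq b_def using True by (simp only: if_True norm_mult norm_of_real mult_1)
  next
    case False
    have "0 \<le> W x" using W(2)[of x x] norm_ge_zero[of "g x"] by linarith
    with False show ?thesis unfolding S_eq by simp
  qed
  have "(\<lambda>M. \<integral>x. S M x \<partial>lborel) \<longlonglongrightarrow> (\<integral>x. g x \<partial>lborel)"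
  proof (rule integral_dominated_convergence[where w = W])
    show "g \<in> borel_measurable lborel" using g by (simp add: borel_measurable_continuous_onI)
    show "S M \<in> borel_measurable lborel" for M unfolding S_def by measurable
  qed (use W(1) lim bound in auto)
  then show ?thesis unfolding S_int .
qed

text \<open>The quadratic form of the double sum is that of \<open>G\<close> itself at the points
  \<open>\<xi> i + \<eta> p\<close> with coefficients \<open>a i * b p\<close>.\<close>

lemma Phi_double_sum:
  assumes G: "G \<in> Phi" and P: "finite P"
  shows "(\<lambda>s. \<Sum>p\<in>P. \<Sum>q\<in>P. b p * G (s + (\<eta> p - \<eta> q)) * cnj (b q)) \<in> Phi"
  unfolding Phi_def
proof safe
  fix n :: nat and \<xi> :: "nat \<Rightarrow> 'a" and a :: "nat \<Rightarrow> complex"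
  let ?A = "{..<n}"
  have "(\<Sum>i\<in>?A. \<Sum>j\<in>?A. a i * (\<Sum>p\<in>P. \<Sum>q\<in>P. b p * G (\<xi> i - \<xi> j + (\<eta> p - \<eta> q)) * cnj (b q)) * cnj (a j)) =
    (\<Sum>i\<in>?A. \<Sum>j\<in>?A. \<Sum>p\<in>P. \<Sum>q\<in>P. (a i * b p) * G (\<xi> i + \<eta> p - (\<xi> j + \<eta> q)) * cnj (a j * b q))"
    by (simp add: sum_distrib_left sum_distrib_right mult_ac algebra_simps)
  also have "\<dots> = (\<Sum>i\<in>?A. \<Sum>p\<in>P. \<Sum>j\<in>?A. \<Sum>q\<in>P. (a i * b p) * G (\<xi> i + \<eta> p - (\<xi> j + \<eta> q)) * cnj (a j * b q))"
    by (intro sum.cong refl sum.swap)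
  also have "\<dots> = (\<Sum>\<alpha>\<in>?A \<times> P. \<Sum>\<beta>\<in>?A \<times> P. (a (fst \<alpha>) * b (snd \<alpha>)) *
      G (\<xi> (fst \<alpha>) + \<eta> (snd \<alpha>) - (\<xi> (fst \<beta>) + \<eta> (snd \<beta>))) * cnj (a (fst \<beta>) * b (snd \<beta>)))"
    by (simp add: sum.cartesian_product')
  also have "\<dots> \<in> \<real>\<^sub>\<ge>\<^sub>0"
    using Phi_finite_sum[OF G, of "?A \<times> P" "\<lambda>\<alpha>. a (fst \<alpha>) * b (snd \<alpha>)" "\<lambda>\<alpha>. \<xi> (fst \<alpha>) + \<eta> (snd \<alpha>)"] P
    by simp
  finally show "(\<Sum>i<n. \<Sum>j<n. a i * (\<Sum>p\<in>P. \<Sum>q\<in>P. b p * G (\<xi> i - \<xi> j + (\<eta> p - \<eta> q)) * cnj (b q)) * cnj (a j)) \<in> \<real>\<^sub>\<ge>\<^sub>0" .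
qed

text \<open>\<open>Phi_double_sum\<close> with shifts \<open>p / (M + 1)\<close> along
  \<open>e\<close> and unimodular coefficients of frequency \<omega> gives positive definite Fejer
  sums; they tend to the Fourier integral along \<open>e\<close>.\<close>

lemma Phi_fourier_integral:
  fixes G :: "'e::real_vector \<Rightarrow> complex"
  assumes G: "G \<in> Phi" and cont: "\<And>s. continuous_on UNIV (\<lambda>x::real. G (s + x *\<^sub>R e))"
    and dominated: "\<And>s. \<exists>W. integrable lborel W \<and> (\<forall>x y::real. \<bar>y - x\<bar> \<le> 1 \<longrightarrow> norm (G (s + y *\<^sub>R e)) \<le> W x)"
  shows "(\<lambda>s. \<integral>x. cis (\<omega> * x) * G (s + x *\<^sub>R e) \<partial>lborel) \<in> Phi"
proof (rule Phi_tendsto)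
  fix M :: nat
  let ?P = "{..<(Suc M)\<^sup>2}"
  let ?r = "\<lambda>p::nat. real p / real (Suc M)"
  have "(\<lambda>s. complex_of_real (1 / real (Suc M) ^ 3) *
     (\<Sum>p\<in>?P. \<Sum>q\<in>?P. cis (\<omega> * ?r p) * G (s + (?r p *\<^sub>R e - ?r q *\<^sub>R e)) * cnj (cis (\<omega> * ?r q)))) \<in> Phi"
    by (intro Phi_scale Phi_double_sum G) auto
  also have "(\<lambda>s. complex_of_real (1 / real (Suc M) ^ 3) *
     (\<Sum>p\<in>?P. \<Sum>q\<in>?P. cis (\<omega> * ?r p) * G (s + (?r p *\<^sub>R e - ?r q *\<^sub>R e)) * cnj (cis (\<omega> * ?r q)))) =
     (\<lambda>s. (\<Sum>p\<in>?P. \<Sum>q\<in>?P. cis (\<omega> * (?r p - ?r q)) * G (s + (?r p - ?r q) *\<^sub>R e)) / complex_of_real (real (Suc M) ^ 3))"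
  proof (intro ext)
    fix s
    have "cis (\<omega> * ?r p) * G (s + (?r p *\<^sub>R e - ?r q *\<^sub>R e)) * cnj (cis (\<omega> * ?r q)) =
       cis (\<omega> * (?r p - ?r q)) * G (s + (?r p - ?r q) *\<^sub>R e)" for p q
    proof -
      have "cis (\<omega> * (?r p - ?r q)) = cis (\<omega> * ?r p) * cnj (cis (\<omega> * ?r q))"
        by (simp only: cis_cnj cis_mult) (simp add: right_diff_distrib del: of_nat_Suc)
      then show ?thesis by (simp only: scaleR_left_diff_distrib mult_ac)
    qed
    then show "complex_of_real (1 / real (Suc M) ^ 3) *
     (\<Sum>p\<in>?P. \<Sum>q\<in>?P. cis (\<omega> * ?r p) * G (s + (?r p *\<^sub>R e - ?r q *\<^sub>R e)) * cnj (cis (\<omega> * ?r q))) =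
     (\<Sum>p\<in>?P. \<Sum>q\<in>?P. cis (\<omega> * (?r p - ?r q)) * G (s + (?r p - ?r q) *\<^sub>R e)) / complex_of_real (real (Suc M) ^ 3)"
      by (simp only:) (simp del: of_nat_Suc)
  qed
  finally show "(\<lambda>s. (\<Sum>p\<in>?P. \<Sum>q\<in>?P. cis (\<omega> * (?r p - ?r q)) * G (s + (?r p - ?r q) *\<^sub>R e)) / complex_of_real (real (Suc M) ^ 3)) \<in> Phi" .
next
  fix s
  obtain W where W: "integrable lborel W" "\<And>x y::real. \<bar>y - x\<bar> \<le> 1 \<Longrightarrow> norm (G (s + y *\<^sub>R e)) \<le> W x"
    using dominated by blast
  show "(\<lambda>M. (\<Sum>p<(Suc M)\<^sup>2. \<Sum>q<(Suc M)\<^sup>2. cis (\<omega> * (real p / real (Suc M) - real q / real (Suc M))) *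
      G (s + (real p / real (Suc M) - real q / real (Suc M)) *\<^sub>R e)) / complex_of_real (real (Suc M) ^ 3))
     \<longlonglongrightarrow> (\<integral>x. cis (\<omega> * x) * G (s + x *\<^sub>R e) \<partial>lborel)"
    by (rule fejer_riemann_sum_tendsto[of "\<lambda>x. cis (\<omega> * x) * G (s + x *\<^sub>R e)", OF _ W(1)])
       (auto intro!: continuous_intros cont W(2) simp: norm_mult)
qed

subsection \<open>Completely monotone functions as limits of exponential sums\<close>

text \<open>The sign is opposite to that of the forward difference, so that all iterates are
  nonnegative on samples of completely monotone functions.\<close>

definition bdiff :: "(nat \<Rightarrow> 'a::ab_group_add) \<Rightarrow> nat \<Rightarrow> 'a" where
  "bdiff c k = c k - c (Suc k)"

text \<open>The shift \<open>S\<close> and \<open>D = bdiff\<close> commute and satisfy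
  \<open>S + D = 1\<close>; the left side is the binomial expansion of \<open>(S + D)^M\<close>
  applied to \<open>D^r c\<close>.\<close>

lemma sum_binomial_bdiff:
  fixes c :: "nat \<Rightarrow> real"
  shows "(\<Sum>j\<le>M. real (M choose j) * (bdiff ^^ (M - j + r)) c (k + j)) = (bdiff ^^ r) c k"
proof (induction M arbitrary: r k)
  case (Suc M)
  let ?B = "\<lambda>n. (bdiff ^^ n) c"
  have "(\<Sum>j\<le>Suc M. real (Suc M choose j) * ?B (Suc M - j + r) (k + j)) =
     ?B (Suc M + r) k + (\<Sum>j\<le>M. real (M choose Suc j) * ?B (M - j + r) (k + Suc j))
      + (\<Sum>j\<le>M. real (M choose j) * ?B (M - j + r) (Suc k + j))"
    unfolding sum.atMost_Suc_shift by (simp add: algebra_simps sum.distrib)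
  also have "?B (Suc M + r) k + (\<Sum>j\<le>M. real (M choose Suc j) * ?B (M - j + r) (k + Suc j)) =
     (\<Sum>j\<le>Suc M. real (M choose j) * ?B (Suc M - j + r) (k + j))"
    unfolding sum.atMost_Suc_shift by simp
  also have "\<dots> = (\<Sum>j\<le>M. real (M choose j) * ?B (M - j + Suc r) (k + j))"
    by (simp add: Suc_diff_le)
  also have "\<dots> + (\<Sum>j\<le>M. real (M choose j) * ?B (M - j + r) (Suc k + j)) = ?B (Suc r) k + ?B r (Suc k)"
    unfolding Suc ..
  also have "\<dots> = ?B r k"
    by (simp add: bdiff_def[of "?B r"])
  finally show ?case .
qed simp

text \<open>Hausdorff's moment formula: the weights do not depend on \<open>k\<close>, and the
  binomial ratio stands in for a \<open>k\<close>-th power. It is \<open>sum_binomial_bdiff\<close>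
  with \<open>M = N - k\<close> and \<open>i = k + j\<close>.\<close>

lemma bdiff_moment:
  fixes c :: "nat \<Rightarrow> real"
  assumes "k \<le> N"
  shows "c k = (\<Sum>i\<le>N. real (N choose i) * (bdiff ^^ (N - i)) c i * (real (i choose k) / real (N choose k)))"
proof -
  have "c k = (\<Sum>j\<le>N - k. real (N - k choose j) * (bdiff ^^ (N - k - j)) c (k + j))"
    using sum_binomial_bdiff[of "N - k" 0 c k] by simp
  also have "\<dots> = (\<Sum>i\<in>{k..N}. real (N - k choose (i - k)) * (bdiff ^^ (N - i)) c i)"
    using assms by (intro sum.reindex_bij_witness[of _ "\<lambda>i. i - k" "\<lambda>j. k + j"]) auto
  also have "\<dots> = (\<Sum>i\<in>{k..N}. real (N choose i) * (bdiff ^^ (N - i)) c i * (real (i choose k) / real (N choose k)))"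
  proof (intro sum.cong refl)
    fix i assume i: "i \<in> {k..N}"
    then have "real (N choose i) * real (i choose k) = real (N choose k) * real (N - k choose (i - k))"
      using choose_mult[of k i N] by (simp flip: of_nat_mult)
    moreover have "real (N choose k) > 0" using assms by simp
    ultimately show "real (N - k choose (i - k)) * (bdiff ^^ (N - i)) c i =
      real (N choose i) * (bdiff ^^ (N - i)) c i * (real (i choose k) / real (N choose k))"
      by (simp add: field_simps)
  qed
  also have "\<dots> = (\<Sum>i\<le>N. real (N choose i) * (bdiff ^^ (N - i)) c i * (real (i choose k) / real (N choose k)))"
    by (rule sum.mono_neutral_left) auto
  finally show ?thesis .
qed

text \<open>Truncated subtraction makes both sides 0 when \<open>i < k\<close>.\<close>

lemma binomial_ratio_prod:
  assumes "k \<le> N"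
  shows "real (i choose k) / real (N choose k) = (\<Prod>t<k. real (i - t) / real (N - t))"
  using assms
proof (induction k)
  case (Suc k)
  have *: "real (n choose Suc k) = real (n choose k) * real (n - k) / real (Suc k)" for n
  proof -
    have "(n choose Suc k) * Suc k = (n choose k) * (n - k)"
      by (metis binomial_absorb_comp binomial_absorption mult.commute Suc_times_binomial_eq diff_Suc_1 nat.exhaust binomial_eq_0_iff diff_is_0_eq' mult_0 zero_less_Suc le0)
    then show ?thesis by (simp add: field_simps flip: of_nat_mult del: of_nat_Suc)
  qed
  show ?case using Suc unfolding * by (simp add: field_simps del: of_nat_Suc)
qed simp

text \<open>Each of the \<open>k\<close> factors is within \<open>k / (N - k + 1)\<close> of the
  node \<open>(i + 1) / (N + 1)\<close>, and products of numbers in \<open>[0, 1]\<close> differ by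
  at most the sum of the differences of their factors. The added 1 keeps the node positive, so that
  its logarithm can be taken later.\<close>

lemma binomial_ratio_approx:
  assumes k: "k \<le> N" and i: "i \<le> N"
  shows "\<bar>real (i choose k) / real (N choose k) - (real (Suc i) / real (Suc N)) ^ k\<bar> \<le> (real k)\<^sup>2 / real (Suc (N - k))"
proof -
  let ?q = "real (Suc i) / real (Suc N)"
  have factor: "\<bar>real (i - t) / real (N - t) - ?q\<bar> \<le> real k / real (Suc (N - k))" if t: "t < k" for t
  proof (cases "t \<le> i")
    case True
    have "real (i - t) / real (N - t) - ?q = - ((real N - real i) / real (Suc N) * (real (Suc t) / real (N - t)))"
    proof -
      have "real N - real t > 0" using t k by simp
      then show ?thesis
        using True t k by (simp add: of_nat_diff divide_simps) (simp add: algebra_simps)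
    qed
    moreover have "\<bar>(real N - real i) / real (Suc N) * (real (Suc t) / real (N - t))\<bar> \<le> 1 * (real k / real (Suc (N - k)))"
      unfolding abs_mult using t k i by (intro mult_mono) (auto simp: abs_divide intro!: frac_le)
    ultimately show ?thesis by simp
  next
    case False
    then have "?q \<le> real k / real (Suc (N - k))"
      using t k by (intro frac_le) auto
    with False show ?thesis by simp
  qed
  have "\<bar>(\<Prod>t<k. real (i - t) / real (N - t)) - (\<Prod>t<k. ?q)\<bar> \<le> (\<Sum>t<k. \<bar>real (i - t) / real (N - t) - ?q\<bar>)"
    using i norm_prod_diff[of "{..<k}" "\<lambda>t. real (i - t) / real (N - t)" "\<lambda>_. ?q", unfolded real_norm_def]
    by (force simp: divide_le_eq)
  also have "\<dots> \<le> (\<Sum>t<k. real k / real (Suc (N - k)))"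
    using factor by (intro sum_mono) auto
  finally show ?thesis
    unfolding binomial_ratio_prod[OF k] by (simp add: power2_eq_square)
qed

text \<open>\<open>G n\<close> stands for \<open>(-1)^n\<close> times the \<open>n\<close>-th
  derivative. Carrying the whole sequence makes the hypotheses stable under
  \<open>G n x - G n (x + d)\<close>, which is nonnegative because \<open>G n\<close> is
  nonincreasing; each induction step absorbs one difference.\<close>

lemma bdiff_nonneg:
  fixes G :: "nat \<Rightarrow> real \<Rightarrow> real"
  assumes "\<And>n x. x > 0 \<Longrightarrow> (G n has_real_derivative - G (Suc n) x) (at x)"
    and "\<And>n x. x > 0 \<Longrightarrow> G n x \<ge> 0" and "a > 0" "d \<ge> 0"
  shows "(bdiff ^^ n) (\<lambda>k. G 0 (a + real k * d)) k \<ge> 0"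
  using assms(1,2)
proof (induction n arbitrary: G)
  case 0
  then show ?case using \<open>a > 0\<close> \<open>d \<ge> 0\<close> by (simp add: add_pos_nonneg)
next
  case (Suc n)
  define H where "H n x = G n x - G n (x + d)" for n x
  have "(bdiff ^^ n) (\<lambda>k. H 0 (a + real k * d)) k \<ge> 0"
  proof (rule Suc.IH)
    fix n :: nat and x :: real assume x: "x > 0"
    show "(H n has_real_derivative - H (Suc n) x) (at x)"
      unfolding H_def using x \<open>d \<ge> 0\<close>
      using DERIV_diff[OF Suc.prems(1)[of x n] DERIV_shift[THEN iffD1, OF Suc.prems(1)[of "x + d" n]]] by simp
    have "G n (x + d) \<le> G n x"
    proof (rule DERIV_nonpos_imp_nonincreasing[where f = "G n"])
      fix y assume "x \<le> y"
      then show "\<exists>z. (G n has_real_derivative z) (at y) \<and> z \<le> 0"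
        using Suc.prems x by (intro exI[of _ "- G (Suc n) y"]) auto
    qed (use \<open>d \<ge> 0\<close> in simp)
    then show "H n x \<ge> 0" by (simp add: H_def)
  qed
  moreover have "bdiff (\<lambda>k. G 0 (a + real k * d)) = (\<lambda>k. H 0 (a + real k * d))"
    by (auto simp: bdiff_def H_def algebra_simps)
  ultimately show ?case by (simp only: funpow_Suc_right comp_apply)
qed

lemma completely_monotone_bdiff_nonneg:
  assumes "completely_monotone f" "a > 0" "d \<ge> 0"
  shows "(bdiff ^^ n) (\<lambda>k. f (a + real k * d)) k \<ge> 0"
proof -
  define G where "G n x = (-1) ^ n * (deriv ^^ n) f x" for n x
  have "(bdiff ^^ n) (\<lambda>k. G 0 (a + real k * d)) k \<ge> 0"
  proof (rule bdiff_nonneg)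
    fix n :: nat and x :: real assume x: "x > 0"
    have "(deriv ^^ n) f differentiable (at x)"
      using assms(1) x by (auto simp: completely_monotone_def)
    then have "((deriv ^^ n) f has_real_derivative (deriv ^^ Suc n) f x) (at x)"
      by (simp add: DERIV_deriv_iff_real_differentiable)
    from DERIV_cmult[OF this, of "(-1) ^ n"]
    show "(G n has_real_derivative - G (Suc n) x) (at x)"
      by (simp add: G_def[abs_def])
    show "G n x \<ge> 0" using assms(1) x by (auto simp: G_def completely_monotone_def)
  qed fact+
  then show ?thesis by (simp add: G_def)
qed

text \<open>
  By Hausdorff's moment argument the values of \<open>f\<close> on a shifted lattice of mesh \<open>1 / m\<close> are
  approximately the moments of a discrete measure on \<open>(0, 1]\<close>, i.e. the lattice values of a
  positive combination of exponentials. Such a combination is decreasing, so its values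
  between the lattice points are controlled as well. The shift keeps the lattice inside \<open>{0<..}\<close>.
\<close>

lemma completely_monotone_approx:
  fixes f :: "real \<Rightarrow> real"
  assumes cont: "continuous_on {0..} f" and cm: "completely_monotone f" and "\<epsilon> > 0"
  shows "\<exists>N (w :: nat \<Rightarrow> real) u. (\<forall>i. w i \<ge> 0 \<and> u i \<ge> 0) \<and>
    (\<forall>s\<in>{0..R}. \<bar>(\<Sum>i\<le>N. w i * exp (- u i * s)) - f s\<bar> \<le> \<epsilon>)"
proof -
  \<comment> \<open>The interval extends to \<open>R + 2\<close> because \<open>s\<close> is
    compared with lattice points up to \<open>s + 2 / m\<close>.\<close>
  have "uniformly_continuous_on {0..R + 2} f"
    by (intro compact_uniformly_continuous continuous_on_subset[OF cont]) auto
  then obtain \<delta> where \<delta>: "\<delta> > 0"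
    "\<And>x y. x \<in> {0..R + 2} \<Longrightarrow> y \<in> {0..R + 2} \<Longrightarrow> dist x y < \<delta> \<Longrightarrow> dist (f x) (f y) < \<epsilon> / 2"
    using \<open>\<epsilon> > 0\<close> unfolding uniformly_continuous_on_def by (metis half_gt_zero)
  obtain m :: nat where m': "real m > max 1 (2 / \<delta>)"
    using reals_Archimedean2 by blast
  then have m: "m > 0" "2 / real m < \<delta>" "1 / real m \<le> 1" "2 / real m \<le> 2"
    using \<delta>(1) by (auto simp: field_simps)
  define c where "c k = f (1 / m + real k * (1 / m))" for k :: nat
  \<comment> \<open>Every \<open>s\<close> in \<open>{0..R}\<close> lies between two neighbouring
    lattice points of index at most \<open>K\<close>.\<close>
  define K where "K = nat \<lceil>m * R\<rceil> + 1"
  have c_pos: "(bdiff ^^ n) c k \<ge> 0" for n k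
    unfolding c_def using m by (intro completely_monotone_bdiff_nonneg[OF cm]) auto
  \<comment> \<open>Makes the total mass \<open>c 0\<close> times the ratio error
    \<open>K^2 / (L + 1)\<close> at most \<open>\<epsilon> / 2\<close>.\<close>
  obtain L :: nat where L: "real L > c 0 * (real K)\<^sup>2 * 2 / \<epsilon>"
    using reals_Archimedean2 by blast
  define N where "N = K + L"
  define w where "w i = real (N choose i) * (bdiff ^^ (N - i)) c i" for i
  define q where "q i = real (Suc i) / real (Suc N)" for i
  \<comment> \<open>Chosen so that \<open>exp (- u i * (k / m)) = q i ^ k\<close>; beyond
    \<open>N\<close>, where \<open>q i > 1\<close>, the value 0 keeps \<open>u\<close>
    nonnegative.\<close>
  define u where "u i = (if i \<le> N then - m * ln (q i) else 0)" for i
  have q: "0 < q i" "i \<le> N \<Longrightarrow> q i \<le> 1" for i by (auto simp: q_def)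
  have w: "w i \<ge> 0" for i using c_pos by (simp add: w_def)
  have u: "u i \<ge> 0" for i using q[of i] by (auto simp: u_def mult_nonneg_nonpos2 mult_nonneg_nonpos)
  define \<psi> where "\<psi> s = (\<Sum>i\<le>N. w i * exp (- u i * s))" for s
  have \<psi>_antimono: "\<psi> t \<le> \<psi> s" if "s \<le> t" for s t
    unfolding \<psi>_def using that w u by (intro sum_mono mult_left_mono) (auto intro: mult_left_mono)
  \<comment> \<open>The argument of \<open>f\<close> is one lattice step ahead because the sequence
    \<open>c\<close> starts at \<open>1 / m\<close>.\<close>
  have lattice: "\<bar>\<psi> (k / m) - f ((k + 1) / m)\<bar> \<le> \<epsilon> / 2" if k: "k \<le> K" for k :: nat
  proof -
    have "exp (- u i * (k / m)) = q i ^ k" if "i \<le> N" for i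
      using that m q[of i] by (simp add: u_def exp_of_nat2_mult)
    then have "\<psi> (k / m) = (\<Sum>i\<le>N. w i * q i ^ k)" by (simp add: \<psi>_def)
    moreover have "f ((k + 1) / m) = (\<Sum>i\<le>N. w i * (real (i choose k) / real (N choose k)))"
      using bdiff_moment[of k N c] k by (simp add: c_def w_def N_def add_divide_distrib add.commute)
    ultimately have "\<bar>\<psi> (k / m) - f ((k + 1) / m)\<bar> =
       \<bar>\<Sum>i\<le>N. w i * (real (i choose k) / real (N choose k) - q i ^ k)\<bar>"
      by (simp add: sum_subtractf right_diff_distrib)
    also have "\<dots> \<le> (\<Sum>i\<le>N. w i * ((real k)\<^sup>2 / real (Suc (N - k))))"
    proof (rule order_trans[OF sum_abs], intro sum_mono)
      fix i assume "i \<in> {..N}"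
      then show "\<bar>w i * (real (i choose k) / real (N choose k) - q i ^ k)\<bar> \<le> w i * ((real k)\<^sup>2 / real (Suc (N - k)))"
        unfolding abs_mult q_def using w[of i] k binomial_ratio_approx[of k N i]
        by (intro mult_mono) (auto simp: N_def)
    qed
    also have "\<dots> = c 0 * ((real k)\<^sup>2 / real (Suc (N - k)))"
      using bdiff_moment[of 0 N c] by (simp add: w_def sum_distrib_right sum_divide_distrib)
    also have "\<dots> \<le> c 0 * ((real K)\<^sup>2 / real (Suc L))"
      using k c_pos[of 0 0] by (intro mult_left_mono frac_le power_mono) (auto simp: N_def)
    also have "\<dots> \<le> \<epsilon> / 2"
      using L \<open>\<epsilon> > 0\<close> by (simp add: field_simps)
    finally show ?thesis .
  qed
  have "\<bar>\<psi> s - f s\<bar> \<le> \<epsilon>" if s: "s \<in> {0..R}" for s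
  proof -
    define k where "k = nat \<lfloor>m * s\<rfloor>"
    have "real k \<le> m * s" "m * s < real k + 1" using s m unfolding k_def by auto
    then have k: "k / m \<le> s" "s \<le> (k + 1) / m" using m by (auto simp: field_simps)
    have "m * s \<le> m * R" using s m by simp
    then have "k + 1 \<le> K" unfolding k_def K_def by linarith
    have near: "\<bar>f x - f s\<bar> \<le> \<epsilon> / 2" if "s \<le> x" "x \<le> s + 2 / m" for x
      using \<delta>(2)[of x s] that s m by (auto simp: dist_real_def)
    \<comment> \<open>Monotonicity squeezes \<open>\<psi> s\<close> between two lattice values.
      These are \<open>\<epsilon> / 2\<close>-close to \<open>f ((k + 1) / m)\<close> and
      \<open>f ((k + 2) / m)\<close>, which are \<open>\<epsilon> / 2\<close>-close to
      \<open>f s\<close>.\<close>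
    have "\<psi> s \<le> \<psi> (k / m)" "\<psi> ((k + 1) / m) \<le> \<psi> s" using k by (auto intro: \<psi>_antimono)
    moreover have "\<bar>\<psi> (k / m) - f ((k + 1) / m)\<bar> \<le> \<epsilon> / 2"
      "\<bar>\<psi> ((k + 1) / m) - f ((k + 2) / m)\<bar> \<le> \<epsilon> / 2"
      using lattice[of k] lattice[of "k + 1"] \<open>k + 1 \<le> K\<close> by (auto simp: add_ac)
    moreover have "s \<le> (k + 2) / m" "(k + 1) / m \<le> s + 2 / m" "(k + 2) / m \<le> s + 2 / m"
    proof -
      define b where "b = 1 / real m"
      have b: "(k + 1) / m = k / m + b" "(k + 2) / m = k / m + 2 * b" "2 / m = 2 * b" "0 < b"
        using m by (simp_all add: b_def field_simps)
      show "s \<le> (k + 2) / m" "(k + 1) / m \<le> s + 2 / m" "(k + 2) / m \<le> s + 2 / m"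
        using k b(4) unfolding b(1-3) by linarith+
    qed
    then have "\<bar>f ((k + 1) / m) - f s\<bar> \<le> \<epsilon> / 2" "\<bar>f ((k + 2) / m) - f s\<bar> \<le> \<epsilon> / 2"
      using k near[of "(k + 1) / m"] near[of "(k + 2) / m"] by blast+
    ultimately show ?thesis by linarith
  qed
  with w u show ?thesis unfolding \<psi>_def by (intro exI[of _ N] exI[of _ w] exI[of _ u]) auto
qed

subsection \<open>Gaussian kernels\<close>

text \<open>
  The kernels interpolate between \<open>exp (- l * h t)\<close> (for \<open>I = {}\<close>) and the case
  \<open>\<phi> s = exp (- s / 4)\<close> of the function \<open>K\<close> in (1) (for \<open>I = UNIV\<close> and \<open>l = 0\<close>).
\<close>

definition gaussian_kernel :: "('e \<Rightarrow> real) \<Rightarrow> 'd::finite set \<Rightarrow> real \<Rightarrow> (real ^ 'd) \<times> 'e \<Rightarrow> real" where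
  "gaussian_kernel h I l s =
     exp (- l * h (snd s)) * (\<Prod>k\<in>I. exp (- (fst s $ k)\<^sup>2 / (4 * h (snd s))) / sqrt (h (snd s)))"

lemma gaussian_kernel_insert:
  "k \<notin> I \<Longrightarrow> gaussian_kernel h (insert k I) l s =
     gaussian_kernel h I l s / sqrt (h (snd s)) * exp (- (fst s $ k)\<^sup>2 / (4 * h (snd s)))"
  by (simp add: gaussian_kernel_def)

lemma gaussian_kernel_add:
  "gaussian_kernel h I (l + m) s = gaussian_kernel h I l s * exp (- m * h (snd s))"
  by (simp add: gaussian_kernel_def algebra_simps exp_add exp_diff exp_minus field_simps)

lemma gaussian_kernel_translate:
  assumes "k \<notin> I"
  shows "gaussian_kernel h (insert k I) l (s + x *\<^sub>R (axis k 1, 0)) =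
    gaussian_kernel h I l s / sqrt (h (snd s)) * exp (- (1 / (4 * h (snd s))) * (x + fst s $ k)\<^sup>2)"
proof -
  have "gaussian_kernel h I l (s + x *\<^sub>R (axis k 1, 0)) = gaussian_kernel h I l s"
    unfolding gaussian_kernel_def using assms
    by (auto intro!: prod.cong simp: axis_def)
  then show ?thesis
    using assms by (simp add: gaussian_kernel_insert axis_def add.commute)
qed

lemma gaussian_kernel_UNIV:
  fixes s :: "(real ^ 'd::finite) \<times> 'e"
  assumes h: "h (snd s) > 0"
  shows "gaussian_kernel h UNIV l s =
    exp (- l * h (snd s)) * (h (snd s) powr (- (real CARD('d) / 2)) * exp (- (norm (fst s))\<^sup>2 / (4 * h (snd s))))"
proof -
  have "(norm (fst s))\<^sup>2 = (\<Sum>k\<in>UNIV. (fst s $ k)\<^sup>2)"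
    unfolding power2_norm_eq_inner by (simp add: inner_vec_def power2_eq_square)
  then have "(\<Prod>k\<in>UNIV. exp (- (fst s $ k)\<^sup>2 / (4 * h (snd s)))) = exp (- (norm (fst s))\<^sup>2 / (4 * h (snd s)))"
    by (simp add: exp_sum[symmetric] sum_negf[symmetric] sum_divide_distrib)
  moreover have "h (snd s) powr (real CARD('d) / 2) = sqrt (h (snd s)) ^ CARD('d)"
    using h by (simp add: powr_half_sqrt[symmetric] powr_realpow[symmetric] powr_powr)
  ultimately show ?thesis
    unfolding gaussian_kernel_def using h
    by (simp add: prod_dividef powr_minus field_simps)
qed

text \<open>Up to \<open>1 / sqrt pi\<close>, the new factor is the integral over \<open>y\<close>
  of a character in coordinate \<open>k\<close> times \<open>exp (- y^2 * h)\<close>. The latter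
  merely raises \<open>l\<close> to \<open>l + y^2\<close>, which the hypothesis covers.\<close>

lemma Phi_gaussian_kernel_insert:
  fixes h :: "'e::real_vector \<Rightarrow> real" and I :: "'d::finite set"
  assumes h: "\<And>t. h t > 0" and k: "k \<notin> I" and l: "l > 0"
    and Phi: "\<And>l. l > 0 \<Longrightarrow> (\<lambda>s. complex_of_real (gaussian_kernel h I l s)) \<in> Phi"
  shows "(\<lambda>s. complex_of_real (gaussian_kernel h (insert k I) l s)) \<in> Phi"
proof -
  define f where "f y s = cis (fst s $ k * y) * complex_of_real (gaussian_kernel h I (l + y\<^sup>2) s)"
    for y :: real and s :: "(real ^ 'd) \<times> 'e"
  have f_eq: "f y s = complex_of_real (gaussian_kernel h I l s) *
     (cis (fst s $ k * y) * complex_of_real (exp (- h (snd s) * (y + 0)\<^sup>2)))" for y s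
    by (simp add: f_def gaussian_kernel_add mult_ac)
  have "(\<lambda>s. \<integral>y. f y s \<partial>lborel) \<in> Phi"
  proof (rule Phi_integral)
    show "f y \<in> Phi" for y
      unfolding f_def using l
      by (intro Phi_mult_cis Phi) (auto simp: algebra_simps add_pos_nonneg)
    show "integrable lborel (\<lambda>y. f y s)" for s
      unfolding f_eq by (intro integrable_mult_right gaussian_fourier(1) h)
  qed
  from Phi_scale[OF this, of "1 / sqrt pi"]
  have "(\<lambda>s. complex_of_real (1 / sqrt pi) * (\<integral>y. f y s \<partial>lborel)) \<in> Phi" by simp
  moreover have "complex_of_real (1 / sqrt pi) * (\<integral>y. f y s \<partial>lborel) =
     complex_of_real (gaussian_kernel h (insert k I) l s)" for s
    unfolding f_eq integral_mult_right_zero gaussian_fourier(2)[OF h] using k h[of "snd s"]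
    by (simp add: gaussian_kernel_insert real_sqrt_divide field_simps)
  ultimately show ?thesis by simp
qed

text \<open>The Fourier transform in coordinate \<open>k\<close> at frequency \<omega> turns the
  Gaussian factor into a constant times \<open>exp (- \<omega>^2 * h)\<close>; the
  \<open>sqrt h\<close> from the integral cancels the one in the kernel.\<close>

lemma Phi_gaussian_kernel_remove:
  fixes h :: "'e::real_vector \<Rightarrow> real" and I :: "'d::finite set"
  assumes h: "\<And>t. h t > 0" and k: "k \<notin> I"
    and Phi: "(\<lambda>s. complex_of_real (gaussian_kernel h (insert k I) l s)) \<in> Phi"
  shows "(\<lambda>s. complex_of_real (gaussian_kernel h I (l + \<omega>\<^sup>2) s)) \<in> Phi"
proof -
  define e :: "(real ^ 'd) \<times> 'e" where "e = (axis k 1, 0)"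
  define G where "G s = complex_of_real (gaussian_kernel h (insert k I) l s)" for s
  have G: "G (s + x *\<^sub>R e) = complex_of_real (gaussian_kernel h I l s / sqrt (h (snd s))) *
      complex_of_real (exp (- (1 / (4 * h (snd s))) * (x + fst s $ k)\<^sup>2))" for s x
    unfolding G_def e_def gaussian_kernel_translate[OF k] of_real_mult ..
  have "(\<lambda>s. \<integral>x. cis (\<omega> * x) * G (s + x *\<^sub>R e) \<partial>lborel) \<in> Phi"
  proof (rule Phi_fourier_integral)
    show "G \<in> Phi" using Phi unfolding G_def .
    show "continuous_on UNIV (\<lambda>x. G (s + x *\<^sub>R e))" for s
      unfolding G by (intro continuous_intros)
    fix s :: "(real ^ 'd) \<times> 'e"
    define H b where "H = h (snd s)" and "b = fst s $ k"
    have H: "H > 0" using h by (simp add: H_def)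
    define A where "A = \<bar>gaussian_kernel h I l s / sqrt H\<bar>"
    \<comment> \<open>Halving the decay rate leaves room to move by at most 1, since then
      \<open>(x + b)^2 \<le> 2 * (y + b)^2 + 2\<close>.\<close>
    define W where "W x = A * exp (1 / (4 * H)) * exp (- (1 / (8 * H)) * (x + b)\<^sup>2)" for x
    have "norm (G (s + y *\<^sub>R e)) \<le> W x" if "\<bar>y - x\<bar> \<le> 1" for x y
    proof -
      have "(y - x)\<^sup>2 \<le> 1" using that by (simp add: abs_square_le_1)
      moreover have "0 \<le> (y + b + (y - x))\<^sup>2" by simp
      then have "(x + b)\<^sup>2 \<le> 2 * (y + b)\<^sup>2 + 2 * (y - x)\<^sup>2"
        by (simp add: power2_eq_square algebra_simps)
      ultimately have "(x + b)\<^sup>2 \<le> 2 * (y + b)\<^sup>2 + 2" by linarith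
      then have "- (1 / (4 * H)) * (y + b)\<^sup>2 \<le> 1 / (4 * H) + - (1 / (8 * H)) * (x + b)\<^sup>2"
        using H by (simp add: field_simps)
      then have "A * exp (- (1 / (4 * H)) * (y + b)\<^sup>2) \<le> A * exp (1 / (4 * H) + - (1 / (8 * H)) * (x + b)\<^sup>2)"
        by (intro mult_left_mono) (simp_all only: exp_le_cancel_iff, simp add: A_def)
      also have "\<dots> = W x" by (simp only: W_def exp_add mult.assoc)
      finally show ?thesis
        unfolding G H_def[symmetric] b_def[symmetric] by (simp only: norm_mult norm_of_real A_def abs_exp_cancel)
    qed
    moreover have "integrable lborel W"
      unfolding W_def using H by (intro integrable_mult_right integrable_gaussian) simp
    ultimately show "\<exists>W. integrable lborel W \<and> (\<forall>x y. \<bar>y - x\<bar> \<le> 1 \<longrightarrow> norm (G (s + y *\<^sub>R e)) \<le> W x)"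
      by blast
  qed
  \<comment> \<open>The integral carries the phase \<open>cis (- \<omega> * fst s $ k)\<close>,
    which the character removes, and the constant \<open>2 * sqrt pi\<close>.\<close>
  then have "(\<lambda>s. complex_of_real (1 / (2 * sqrt pi)) *
     (cis (\<omega> * fst s $ k) * (\<integral>x. cis (\<omega> * x) * G (s + x *\<^sub>R e) \<partial>lborel))) \<in> Phi"
    by (intro Phi_scale Phi_mult_cis) (auto simp: right_diff_distrib)
  moreover have "complex_of_real (1 / (2 * sqrt pi)) *
     (cis (\<omega> * fst s $ k) * (\<integral>x. cis (\<omega> * x) * G (s + x *\<^sub>R e) \<partial>lborel)) =
     complex_of_real (gaussian_kernel h I (l + \<omega>\<^sup>2) s)" for s
  proof -
    define H b A where "H = h (snd s)" and "b = fst s $ k" and "A = gaussian_kernel h I l s"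
    have H: "H > 0" using h by (simp add: H_def)
    then have c: "1 / (4 * H) > 0" by simp
    have "(\<integral>x. cis (\<omega> * x) * G (s + x *\<^sub>R e) \<partial>lborel) =
      complex_of_real (A / sqrt H) * (cis (- \<omega> * b) * complex_of_real (sqrt (pi / (1 / (4 * H))) * exp (- \<omega>\<^sup>2 / (4 * (1 / (4 * H))))))"
      unfolding G H_def[symmetric] b_def[symmetric] A_def[symmetric] gaussian_fourier(2)[OF c, symmetric]
        integral_mult_right_zero[symmetric] by (simp only: mult_ac)
    moreover have "sqrt (pi / (1 / (4 * H))) = 2 * sqrt pi * sqrt H"
      using H by (simp add: real_sqrt_mult)
    moreover have "- \<omega>\<^sup>2 / (4 * (1 / (4 * H))) = - \<omega>\<^sup>2 * H" using H by simp
    moreover have "cis (\<omega> * b) * cis (- \<omega> * b) = 1" by (simp add: cis_mult)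
    ultimately show ?thesis
      using H unfolding gaussian_kernel_add H_def[symmetric] b_def[symmetric] A_def[symmetric]
      by (simp add: mult_ac)
  qed
  ultimately show ?thesis by simp
qed

lemma completely_monotone_exp:
  assumes "c \<ge> 0"
  shows "completely_monotone (\<lambda>x. exp (- c * x))"
proof -
  have "(deriv ^^ n) (\<lambda>x. exp (- c * x)) = (\<lambda>x. (- c) ^ n * exp (- c * x))" for n
  proof (induction n)
    case (Suc n)
    have "deriv (\<lambda>x. (- c) ^ n * exp (- c * x)) x = (- c) ^ Suc n * exp (- c * x)" for x
      by (rule DERIV_imp_deriv) (auto intro!: derivative_eq_intros)
    with Suc show ?case by auto
  qed simp
  note deriv = this
  have "(-1) ^ n * ((- c) ^ n * exp (- c * x)) \<ge> 0" for n x
    using assms by (simp add: mult.assoc[symmetric] power_mult_distrib[symmetric])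
  moreover have "(\<lambda>x. (- c) ^ n * exp (- c * x)) differentiable (at x)" for n x
    unfolding real_differentiable_def
    by (rule exI) (auto intro!: derivative_eq_intros)
  ultimately show ?thesis
    unfolding completely_monotone_def deriv by (intro allI impI conjI)
qed

text \<open>Removal at frequency 0 leaves \<open>l\<close> unchanged, so coordinates can be stripped
  off one at a time.\<close>

lemma Phi_gaussian_kernel_empty:
  fixes h :: "'e::real_vector \<Rightarrow> real" and I :: "'d::finite set"
  assumes h: "\<And>t. h t > 0" and Phi: "(\<lambda>s. complex_of_real (gaussian_kernel h I l s)) \<in> Phi"
  shows "(\<lambda>s :: (real ^ 'd) \<times> 'e. complex_of_real (gaussian_kernel h {} l s)) \<in> Phi"
  using finite[of I] Phi
proof (induction I rule: finite_induct)
  case (insert k I)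
  then show ?case using Phi_gaussian_kernel_remove[OF h insert.hyps(2) insert.prems, of 0] by simp
qed

section \<open>Equivalence of the two positive definiteness conditions\<close>

theorem theorem3:
  fixes h :: "'e::real_vector \<Rightarrow> real"
  assumes "h \<in> C_space" and "\<And>t. h t > 0"
  shows "(\<forall>\<phi> :: real \<Rightarrow> real. continuous_on {0..} \<phi> \<and> completely_monotone \<phi> \<longrightarrow>
            (\<lambda>(x :: real ^ 'd::finite, t :: 'e).
               complex_of_real (h t powr (- (real CARD('d) / 2)) * \<phi> ((norm x)\<^sup>2 / h t))) \<in> Phi)
     \<longleftrightarrow> (\<forall>l>0. (\<lambda>t. complex_of_real (exp (- l * h t))) \<in> Phi)"
proof (intro iffI allI impI)
  note h = assms(2)
  fix l :: real
  assume *: "\<forall>\<phi>. continuous_on {0..} \<phi> \<and> completely_monotone \<phi> \<longrightarrow>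
            (\<lambda>(x :: real ^ 'd, t :: 'e).
               complex_of_real (h t powr (- (real CARD('d) / 2)) * \<phi> ((norm x)\<^sup>2 / h t))) \<in> Phi"
    and l: "l > 0"
  have "completely_monotone (\<lambda>s. exp (- (1 / 4) * s))" by (rule completely_monotone_exp) simp
  moreover have "continuous_on {0..} (\<lambda>s::real. exp (- (1 / 4) * s))" by (intro continuous_intros)
  ultimately have "(\<lambda>(x :: real ^ 'd, t :: 'e). complex_of_real (h t powr (- (real CARD('d) / 2)) *
      exp (- (1 / 4) * ((norm x)\<^sup>2 / h t)))) \<in> Phi"
    using *[rule_format, of "\<lambda>s. exp (- (1 / 4) * s)"] by blast
  then have 1: "(\<lambda>s :: (real ^ 'd) \<times> 'e. complex_of_real (gaussian_kernel h UNIV 0 s)) \<in> Phi"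
    using h by (simp add: gaussian_kernel_UNIV case_prod_unfold)
  \<comment> \<open>A coordinate exists because types are nonempty, i.e. \<open>d \<ge> 1\<close>.
    Removing it at frequency \<open>sqrt l\<close> creates the parameter \<open>l\<close>; the
    others are removed at frequency 0.\<close>
  obtain k :: 'd where True by blast
  have "insert k (UNIV - {k}) = UNIV" by auto
  with 1 have "(\<lambda>s :: (real ^ 'd) \<times> 'e. complex_of_real (gaussian_kernel h (UNIV - {k}) (0 + (sqrt l)\<^sup>2) s)) \<in> Phi"
    by (intro Phi_gaussian_kernel_remove h) auto
  then have "(\<lambda>s :: (real ^ 'd) \<times> 'e. complex_of_real (gaussian_kernel h {} l s)) \<in> Phi"
    using l h by (intro Phi_gaussian_kernel_empty[where I = "UNIV - {k}"]) auto
  from Phi_compose[OF this, of "\<lambda>t. (0, t)"]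
  show "(\<lambda>t. complex_of_real (exp (- l * h t))) \<in> Phi"
    by (simp add: gaussian_kernel_def)
next
  note h = assms(2)
  fix \<phi> :: "real \<Rightarrow> real"
  assume exp_Phi: "\<forall>l>0. (\<lambda>t. complex_of_real (exp (- l * h t))) \<in> Phi"
    and \<phi>: "continuous_on {0..} \<phi> \<and> completely_monotone \<phi>"
  define K where "K \<psi> s = complex_of_real (h (snd s) powr (- (real CARD('d) / 2)) * \<psi> ((norm (fst s))\<^sup>2 / h (snd s)))"
    for \<psi> and s :: "(real ^ 'd) \<times> 'e"
  have "(\<lambda>s :: (real ^ 'd) \<times> 'e. complex_of_real (gaussian_kernel h I l s)) \<in> Phi" if "l > 0" for I l
    using finite[of I] that
  proof (induction I arbitrary: l rule: finite_induct)
    case empty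
    then show ?case
      using Phi_compose[of "\<lambda>t. complex_of_real (exp (- l * h t))" "snd :: (real ^ 'd) \<times> 'e \<Rightarrow> 'e"] exp_Phi
      by (simp add: gaussian_kernel_def)
  next
    case (insert k I)
    then show ?case by (intro Phi_gaussian_kernel_insert h) auto
  qed
  \<comment> \<open>Insertion works for \<open>l > 0\<close> only, so the parameter 0 is reached as
    a limit.\<close>
  then have "(\<lambda>s :: (real ^ 'd) \<times> 'e. complex_of_real (gaussian_kernel h UNIV (1 / real (Suc n)) s)) \<in> Phi" for n
    by simp
  then have "(\<lambda>s :: (real ^ 'd) \<times> 'e. complex_of_real (gaussian_kernel h UNIV 0 s)) \<in> Phi"
  proof (rule Phi_tendsto)
    fix s :: "(real ^ 'd) \<times> 'e"
    have "(\<lambda>n. 1 / real (Suc n)) \<longlonglongrightarrow> 0" by real_asymp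
    then have "(\<lambda>n. gaussian_kernel h UNIV 0 s * exp (- (1 / real (Suc n)) * h (snd s))) \<longlonglongrightarrow>
       gaussian_kernel h UNIV 0 s * exp (- 0 * h (snd s))"
      by (intro tendsto_mult tendsto_exp tendsto_minus tendsto_const)
    then show "(\<lambda>n. complex_of_real (gaussian_kernel h UNIV (1 / real (Suc n)) s)) \<longlonglongrightarrow>
       complex_of_real (gaussian_kernel h UNIV 0 s)"
      unfolding gaussian_kernel_add[symmetric] add_0 by (rule tendsto_of_real)
  qed
  \<comment> \<open>Rescaling \<open>x\<close> by \<open>2 * sqrt u\<close> changes the rate
    \<open>1 / 4\<close> into \<open>u\<close>.\<close>
  then have exp_K: "K (\<lambda>x. exp (- u * x)) \<in> Phi" if "u \<ge> 0" for u
    using Phi_compose[of "\<lambda>s :: (real ^ 'd) \<times> 'e. complex_of_real (gaussian_kernel h UNIV 0 s)"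
       "\<lambda>s. ((2 * sqrt u) *\<^sub>R fst s, snd s)"] that h
    by (simp add: gaussian_kernel_UNIV K_def[abs_def] algebra_simps power_mult_distrib)
  \<comment> \<open>The error is \<open>1 / (n + 1)\<close> on \<open>[0, n]\<close>; every fixed
    argument is eventually covered, so the approximants converge pointwise.\<close>
  define approx where "approx n N w u \<longleftrightarrow> (\<forall>i::nat. w i \<ge> 0 \<and> u i \<ge> 0) \<and>
     (\<forall>s\<in>{0..real n}. \<bar>(\<Sum>i\<le>N. w i * exp (- u i * s)) - \<phi> s\<bar> \<le> 1 / real (Suc n))" for n N w u
  have "\<exists>N w u. approx n N w u" for n
    unfolding approx_def by (rule completely_monotone_approx[OF conjunct1[OF \<phi>] conjunct2[OF \<phi>]]) simp
  then obtain N w u where "\<And>n. approx n (N n) (w n) (u n)"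
    by metis
  then have wu: "\<And>n i. w n i \<ge> 0 \<and> u n i \<ge> 0"
     "\<And>n s. s \<in> {0..real n} \<Longrightarrow> \<bar>(\<Sum>i\<le>N n. w n i * exp (- u n i * s)) - \<phi> s\<bar> \<le> 1 / real (Suc n)"
    unfolding approx_def by blast+
  define \<psi> where "\<psi> n s = (\<Sum>i\<le>N n. w n i * exp (- u n i * s))" for n s
  have "K \<phi> \<in> Phi"
  proof (rule Phi_tendsto)
    fix n
    have "K (\<psi> n) = (\<lambda>s. \<Sum>i\<le>N n. complex_of_real (w n i) * K (\<lambda>x. exp (- u n i * x)) s)"
      by (auto simp: K_def \<psi>_def sum_distrib_left mult_ac)
    also have "\<dots> \<in> Phi"
      by (rule Phi_sum, rule Phi_scale, rule exp_K) (simp_all only: wu(1))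
    finally show "K (\<psi> n) \<in> Phi" .
  next
    fix s :: "(real ^ 'd) \<times> 'e"
    define x where "x = (norm (fst s))\<^sup>2 / h (snd s)"
    have x: "x \<ge> 0" using h[of "snd s"] by (simp add: x_def)
    obtain n0 :: nat where "x \<le> n0" using real_arch_simple by blast
    have "\<bar>\<psi> n x - \<phi> x\<bar> \<le> 1 / real (Suc n)" if "n \<ge> n0" for n
      unfolding \<psi>_def by (rule wu(2)) (use x that \<open>x \<le> n0\<close> in simp)
    then have "\<forall>\<^sub>F n in sequentially. norm (\<psi> n x - \<phi> x) \<le> 1 / real (Suc n)"
      unfolding real_norm_def by (rule eventually_sequentiallyI)
    moreover have "(\<lambda>n. 1 / real (Suc n)) \<longlonglongrightarrow> 0" by real_asymp
    ultimately have "(\<lambda>n. \<psi> n x - \<phi> x) \<longlonglongrightarrow> 0"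
      by (rule Lim_null_comparison)
    then have "(\<lambda>n. \<psi> n x) \<longlonglongrightarrow> \<phi> x" by (rule LIM_zero_cancel)
    then show "(\<lambda>n. K (\<psi> n) s) \<longlonglongrightarrow> K \<phi> s"
      unfolding K_def x_def[symmetric] by (intro tendsto_of_real tendsto_mult tendsto_const)
  qed
  then show "(\<lambda>(x :: real ^ 'd, t :: 'e).
      complex_of_real (h t powr (- (real CARD('d) / 2)) * \<phi> ((norm x)\<^sup>2 / h t))) \<in> Phi"
    by (simp add: K_def[abs_def] case_prod_unfold)
qed

end
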